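(* Let $N = 2^M$ with $M \ge 1$ an integer, let $k$ be an integer with $2 \le k < N$, and let $g_1,\dots,g_N \ge 0$ and $h_1,\dots,h_N > 0$ be reals with $\sum_{i=1}^N g_i = \sum_{i=1}^N h_i = 1$. Let $\mathrm{DP}_{\mathrm{true}}$ be the table computed by the exact dynamic programming recursion, let $\mathrm{DP}_{\mathrm{mm}}$ be the table computed with the monotone maxima algorithm, and let $\delta_{\max}$ be the quantity determined by $(g_i),(h_i)$ and $N$, all as defined in the context. Then for all $p = 1,2,\dots,N-1$ and $q = 1,2,\dots,k-1$, $$0 \le \mathrm{DP}_{\mathrm{true}}[p][q] - \mathrm{DP}_{\mathrm{mm}}[p][q] \le q\,\delta_{\max},$$ where, as the tables take values in $\mathbb{R}\cup\{-\infty\}$, this is understood as $\mathrm{DP}_{\mathrm{mm}}[p][q] \le \mathrm{DP}_{\mathrm{true}}[p][q] \le \mathrm{DP}_{\mathrm{mm}}[p][q] + q\,\delta_{\max}$.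
   Context: For integers $1 \le i_l \le i_r \le N$, $$d_{\mathrm{KL}}(i_l,i_r) = \left(\sum_{i=i_l}^{i_r} g_i\right) \log_2\left(\frac{\sum_{i=i_l}^{i_r} g_i}{\sum_{i=i_l}^{i_r} h_i}\right),$$ with the convention $0\log_2 0 = 0$. Throughout, $-\infty + x = -\infty$ for real $x$. Both tables $\mathrm{DP}[p][q]$ ($p = 0,\dots,N-1$, $q = 0,\dots,k-1$) satisfy $\mathrm{DP}[0][0] = 0$ and $\mathrm{DP}[p][q] = -\infty$ if exactly one of $p,q$ is $0$. Exact table: for $p,q \ge 1$, $\mathrm{DP}_{\mathrm{true}}[p][q] = \max_{i=1,\dots,p}\bigl(\mathrm{DP}_{\mathrm{true}}[i-1][q-1] + d_{\mathrm{KL}}(i,p)\bigr)$. Table with monotone maxima: for each $q = 1,\dots,k-1$ in turn, form the $(N-1)\times(N-1)$ matrix $A$ with $$A_{p,i} = \begin{cases}\mathrm{DP}_{\mathrm{mm}}[i-1][q-1] + d_{\mathrm{KL}}(i,p) & (1 \le i \le p)\\ -\infty & (i > p),\end{cases}$$ run the monotone maxima algorithm on $A$ to obtain column indices $\hat J(1),\dots,\hat J(N-1)$, and set $\mathrm{DP}_{\mathrm{mm}}[p][q] = A_{p,\hat J(p)}$ for $p=1,\dots,N-1$. Monotone maxima algorithm: called on a block of consecutive rows $a,\dots,b$ and a column range $[L,R]$ (initially rows $1,\dots,N-1$ and columns $[1,N-1]$). If the block is empty, stop. Otherwise take the middle row $m = (a+b)/2$ (always an integer as $N=2^M$), let $\hat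 J(m)$ be the smallest $j \in [L,R]$ maximizing $A_{m,j}$ over $j \in [L,R]$, and recurse on rows $a,\dots,m-1$ with columns $[L,\hat J(m)]$ and on rows $m+1,\dots,b$ with columns $[\hat J(m),R]$. Definition of $\delta_{\max}$: define $\Delta : \{0,1,\dots,N\}^2 \to \mathbb{R}$ by $$\Delta(p,p') = \max_{1 \le i \le i' \le p}\Bigl[-\bigl(d_{\mathrm{KL}}(i,p) + d_{\mathrm{KL}}(i',p')\bigr) + \bigl(d_{\mathrm{KL}}(i,p') + d_{\mathrm{KL}}(i',p)\bigr)\Bigr] \quad (0 < p < p' < N),$$ and $\Delta(p,p') = 0$ otherwise. Define $\delta : \{0,1,\dots,N\}\to\mathbb{R}$ recursively by $\delta(0) = \delta(N) = 0$ and, for $0 < p < N$, $$\delta(p) = \max\bigl(\delta(l) + \Delta(l,p),\ 0,\ \delta(r) + \Delta(p,r)\bigr),$$ where $l = p - 2^m$, $r = p + 2^m$, and $m$ is the largest nonnegative integer such that $2^m$ divides $p$ (so $l$ and $r$ are the nearest rows below and above $p$ in index that are processed before row $p$ by the monotone maxima algorithm, with $l=0$ or $r=N$ if there is none). Finally, $\delta_{\max} = \max_{p=1,\dots,N-1} \delta(p)$. *)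

theory Defs
  imports Complex_Main "HOL-Library.Extended_Real" "HOL-Computational_Algebra.Primes"
begin

(* Weights, rows, columns and table indices are all naturals; the weights g, h are used
   only at indices 1..N.  When the g-sum is 0 the product below is 0, which is the convention
   0 log 0 = 0. *)
definition d_KL :: "(nat \<Rightarrow> real) \<Rightarrow> (nat \<Rightarrow> real) \<Rightarrow> nat \<Rightarrow> nat \<Rightarrow> real" where
  "d_KL g h il ir =
     (\<Sum>i=il..ir. g i) * log 2 ((\<Sum>i=il..ir. g i) / (\<Sum>i=il..ir. h i))"

(* The tables take values in the reals extended by minus infinity; the value plus infinity
   of type ereal never occurs. *)
fun DP_true :: "(nat \<Rightarrow> real) \<Rightarrow> (nat \<Rightarrow> real) \<Rightarrow> nat \<Rightarrow> nat \<Rightarrow> ereal" where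
  "DP_true g h 0 0 = 0"
| "DP_true g h (Suc p) 0 = -\<infinity>"
| "DP_true g h 0 (Suc q) = -\<infinity>"
| "DP_true g h (Suc p) (Suc q) =
     Max ((\<lambda>i. DP_true g h (i - 1) q + ereal (d_KL g h i (Suc p))) ` {1..Suc p})"

definition leftmost_argmax :: "(nat \<Rightarrow> ereal) \<Rightarrow> nat \<Rightarrow> nat \<Rightarrow> nat" where
  "leftmost_argmax f L R = (LEAST j. j \<in> {L..R} \<and> (\<forall>j'\<in>{L..R}. f j' \<le> f j))"

(* The result maps each row of the block a..b to its column index; rows outside the block get
   the dummy value 0.  Rows are numbered from 1, and the guard "1 \<le> a" keeps m - 1 from being
   truncated. *)
function monotone_maxima ::
  "(nat \<Rightarrow> nat \<Rightarrow> ereal) \<Rightarrow> nat \<Rightarrow> nat \<Rightarrow> nat \<Rightarrow> nat \<Rightarrow> nat \<Rightarrow> nat" where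
  "monotone_maxima A a b L R =
     (if 1 \<le> a \<and> a \<le> b then
        (let m = (a + b) div 2; j = leftmost_argmax (A m) L R in
         (\<lambda>p. if p < m then monotone_maxima A a (m - 1) L j p
              else if p = m then j
              else monotone_maxima A (m + 1) b j R p))
      else (\<lambda>p. 0))"
  by pat_completeness auto
termination
  by (relation "measure (\<lambda>(A, a, b, L, R). Suc b - a)") auto

declare monotone_maxima.simps [simp del]

(* The matrix A of one step, where D is the previous column of the table. *)
definition mm_matrix ::
  "(nat \<Rightarrow> real) \<Rightarrow> (nat \<Rightarrow> real) \<Rightarrow> (nat \<Rightarrow> ereal) \<Rightarrow> nat \<Rightarrow> nat \<Rightarrow> ereal" where
  "mm_matrix g h D p i =
     (if 1 \<le> i \<and> i \<le> p then D (i - 1) + ereal (d_KL g h i p) else -\<infinity>)"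

fun DP_mm :: "nat \<Rightarrow> (nat \<Rightarrow> real) \<Rightarrow> (nat \<Rightarrow> real) \<Rightarrow> nat \<Rightarrow> nat \<Rightarrow> ereal" where
  "DP_mm N g h 0 0 = 0"
| "DP_mm N g h (Suc p) 0 = -\<infinity>"
| "DP_mm N g h 0 (Suc q) = -\<infinity>"
| "DP_mm N g h (Suc p) (Suc q) =
     (let A = mm_matrix g h (\<lambda>i. DP_mm N g h i q);
          J = monotone_maxima A 1 (N - 1) 1 (N - 1)
      in A (Suc p) (J (Suc p)))"

definition Delta :: "nat \<Rightarrow> (nat \<Rightarrow> real) \<Rightarrow> (nat \<Rightarrow> real) \<Rightarrow> nat \<Rightarrow> nat \<Rightarrow> real" where
  "Delta N g h p p' =
     (if 0 < p \<and> p < p' \<and> p' < N then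
        Max {- (d_KL g h i p + d_KL g h i' p') + (d_KL g h i p' + d_KL g h i' p) | i i'.
               1 \<le> i \<and> i \<le> i' \<and> i' \<le> p}
      else 0)"

lemma multiplicity_2_shift:
  fixes p :: nat
  assumes "0 < p"
  defines "m \<equiv> multiplicity 2 p"
  shows "2 ^ m \<le> p"
    and "p - 2 ^ m \<noteq> 0 \<Longrightarrow> m < multiplicity 2 (p - 2 ^ m)"
    and "m < multiplicity 2 (p + 2 ^ m)"
proof -
  have dvd: "2 ^ m dvd p"
    unfolding m_def by (rule multiplicity_dvd)
  then show le: "2 ^ m \<le> p"
    using assms(1) by (rule dvd_imp_le)
  obtain c where c: "p = 2 ^ m * c"
    using dvd by (rule dvdE)
  have "\<not> 2 ^ Suc m dvd p"
    using assms(1) unfolding m_def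
    by (subst power_dvd_iff_le_multiplicity) auto
  then have "odd c"
    using c by auto
  then have "2 ^ m * 2 dvd 2 ^ m * (c - 1)" "2 ^ m * 2 dvd 2 ^ m * (c + 1)"
    by (intro mult_dvd_mono; simp)+
  moreover have "p - 2 ^ m = 2 ^ m * (c - 1)" "p + 2 ^ m = 2 ^ m * (c + 1)"
    using c by (simp_all add: algebra_simps)
  ultimately have d: "2 ^ Suc m dvd p - 2 ^ m" "2 ^ Suc m dvd p + 2 ^ m"
    by (metis power_Suc2)+
  show "m < multiplicity 2 (p - 2 ^ m)" if "p - 2 ^ m \<noteq> 0"
    unfolding Suc_le_eq[symmetric] using d(1) that by (intro multiplicity_geI) auto
  show "m < multiplicity 2 (p + 2 ^ m)"
    unfolding Suc_le_eq[symmetric] using d(2) assms(1) by (intro multiplicity_geI) auto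
qed

(* Only 0 \<le> p \<le> N is meaningful; values at p > N are dummies. *)
function delta :: "nat \<Rightarrow> (nat \<Rightarrow> real) \<Rightarrow> (nat \<Rightarrow> real) \<Rightarrow> nat \<Rightarrow> real" where
  "delta N g h p =
     (if 0 < p \<and> p < N then
        (let m = multiplicity 2 p; l = p - 2 ^ m; r = p + 2 ^ m in
         Max {delta N g h l + Delta N g h l p, 0, delta N g h r + Delta N g h p r})
      else 0)"
  by pat_completeness auto
termination
proof (relation "measure (\<lambda>(N, g, h, p). if 0 < p \<and> p < N then N - multiplicity 2 p else 0)",
    goal_cases)
  case 1
  show ?case by simp
next
  case (2 N g h p m l r)
  then have "multiplicity 2 p < N"
    using multiplicity_2_shift(1)[of p] less_exp[of "multiplicity 2 p"] by linarith
  with 2 show ?case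
    using multiplicity_2_shift[of p] by (auto intro: diff_less_mono2)
next
  case (3 N g h p m l r)
  then have "multiplicity 2 p < N"
    using multiplicity_2_shift(1)[of p] less_exp[of "multiplicity 2 p"] by linarith
  with 3 show ?case
    using multiplicity_2_shift[of p] by (auto intro: diff_less_mono2)
qed

declare delta.simps [simp del]

definition delta_max :: "nat \<Rightarrow> (nat \<Rightarrow> real) \<Rightarrow> (nat \<Rightarrow> real) \<Rightarrow> real" where
  "delta_max N g h = Max (delta N g h ` {1..N - 1})"

end

(* Restricting row p to the columns [L, R] between the choices L of row l and R of row r can only
   lose something if the best column of row p lies outside [L, R].  If it lies left of L, exchanging
   it with L between the rows l and p costs at most Delta l p, and row l has already lost at most
   delta l; symmetrically on the right.  Hence row p loses at most delta p, one column of the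
   table loses at most delta_max, and the losses add up over the columns. *)
theory Submission imports Defs begin

lemma leftmost_argmax:
  assumes "L \<le> R"
  shows leftmost_argmax_in: "leftmost_argmax f L R \<in> {L..R}"
    and leftmost_argmax_max: "j \<in> {L..R} \<Longrightarrow> f j \<le> f (leftmost_argmax f L R)"
proof -
  have "Max (f ` {L..R}) \<in> f ` {L..R}"
    using assms by (intro Max_in) auto
  then obtain j0 where "j0 \<in> {L..R}" "f j0 = Max (f ` {L..R})"
    by auto
  then have "j0 \<in> {L..R} \<and> (\<forall>j'\<in>{L..R}. f j' \<le> f j0)"
    by simp
  then have *: "leftmost_argmax f L R \<in> {L..R} \<and> (\<forall>j'\<in>{L..R}. f j' \<le> f (leftmost_argmax f L R))"
    unfolding leftmost_argmax_def by (rule LeastI)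
  then show "leftmost_argmax f L R \<in> {L..R}"
    and "j \<in> {L..R} \<Longrightarrow> f j \<le> f (leftmost_argmax f L R)"
    by auto
qed

text \<open>A smallest maximizer beyond \<open>p\<close> would have the value minus infinity, so
  every entry in the range would, and \<open>L\<close> would be a smaller maximizer. Breaking ties
  to the left thus keeps the chosen column within the triangle even when the range has no finite
  entry.\<close>

lemma leftmost_argmax_le:
  assumes "L \<le> R" "L \<le> p" and inf: "\<And>i. p < i \<Longrightarrow> f i = -\<infinity>"
  shows "leftmost_argmax f L R \<le> p"
proof (rule ccontr)
  assume "\<not> leftmost_argmax f L R \<le> p"
  then have gt: "p < leftmost_argmax f L R" by simp
  then have "f j \<le> f L" if "j \<in> {L..R}" for j
    using leftmost_argmax_max[OF \<open>L \<le> R\<close> that, of f] inf[OF gt] by simp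
  then have "leftmost_argmax f L R \<le> L"
    unfolding leftmost_argmax_def using \<open>L \<le> R\<close> by (intro Least_le) auto
  with gt \<open>L \<le> p\<close> show False by simp
qed

lemma Delta_ge:
  assumes "0 < p" "p < p'" "p' < N" "1 \<le> i" "i \<le> i'" "i' \<le> p"
  shows "- (d_KL g h i p + d_KL g h i' p') + (d_KL g h i p' + d_KL g h i' p) \<le> Delta N g h p p'"
proof -
  let ?f = "\<lambda>(i, i'). - (d_KL g h i p + d_KL g h i' p') + (d_KL g h i p' + d_KL g h i' p)"
  let ?S = "{- (d_KL g h i p + d_KL g h i' p') + (d_KL g h i p' + d_KL g h i' p) | i i'.
               1 \<le> i \<and> i \<le> i' \<and> i' \<le> p}"
  have "?S \<subseteq> ?f ` ({..p} \<times> {..p})"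
    by force
  then have "finite ?S"
    by (rule finite_subset) simp
  then have "- (d_KL g h i p + d_KL g h i' p') + (d_KL g h i p' + d_KL g h i' p) \<le> Max ?S"
    using assms by (intro Max_ge) auto
  then show ?thesis
    using assms by (simp add: Delta_def)
qed

lemma delta_ge:
  fixes p N :: nat
  assumes "0 < p" "p < N" "m = multiplicity 2 p"
  shows "delta N g h (p - 2 ^ m) + Delta N g h (p - 2 ^ m) p \<le> delta N g h p"
    and "0 \<le> delta N g h p"
    and "delta N g h (p + 2 ^ m) + Delta N g h p (p + 2 ^ m) \<le> delta N g h p"
  using assms by (simp_all add: delta.simps[of N g h p] Let_def)

text \<open>For real \<open>x\<close> and \<open>y\<close> this is adding \<open>a' - a\<close> to
  both sides. They stand for table entries, which can be minus infinity and so cannot be subtracted;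
  hence the case split.\<close>

lemma exchange:
  fixes x y :: ereal and a a' b b' e e' :: real
  assumes "x + ereal a \<le> y + ereal b + ereal e" "a' - a + (b - b') + e \<le> e'"
  shows "x + ereal a' \<le> y + ereal b' + ereal e'"
  using assms by (cases x; cases y) auto

text \<open>The entries of \<open>D\<close> are the same in both rows, so passing from row
  \<open>l\<close> to row \<open>p\<close> changes the loss only by \<open>d_KL\<close> terms,
  namely by the expression in \<open>Delta\<close> for the pair \<open>(i, L)\<close>. For
  \<open>1 \<le> i\<close> this pair is admissible because \<open>i < L \<le> l\<close>.\<close>

lemma mm_matrix_exchange_left:
  assumes "0 < l" "l < p" "p < N" "i < L" "L \<le> l"
    and loss: "mm_matrix g h D l i \<le> mm_matrix g h D l L + ereal e"
    and e': "e + Delta N g h l p \<le> e'"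
  shows "mm_matrix g h D p i \<le> mm_matrix g h D p L + ereal e'"
proof (cases "1 \<le> i")
  case True
  show ?thesis
    using exchange[of "D (i - 1)" "d_KL g h i l" "D (L - 1)" "d_KL g h L l" e
        "d_KL g h i p" "d_KL g h L p" e'] Delta_ge[of l p N i L g h] True assms
    by (simp add: mm_matrix_def)
qed (simp add: mm_matrix_def)

text \<open>Now the loss is known in the larger row and \<open>R\<close> is the smaller column, so
  the change is the expression in \<open>Delta\<close> for the pair \<open>(R, i)\<close>. It is
  admissible if \<open>i \<le> p\<close>; beyond that the entry is minus infinity.\<close>

lemma mm_matrix_exchange_right:
  assumes "0 < p" "p < r" "r < N" "1 \<le> R" "R < i"
    and loss: "mm_matrix g h D r i \<le> mm_matrix g h D r R + ereal e"
    and e': "e + Delta N g h p r \<le> e'"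
  shows "mm_matrix g h D p i \<le> mm_matrix g h D p R + ereal e'"
proof (cases "i \<le> p")
  case True
  show ?thesis
    using exchange[of "D (i - 1)" "d_KL g h i r" "D (R - 1)" "d_KL g h R r" e
        "d_KL g h i p" "d_KL g h R p" e'] Delta_ge[of p r N R i g h] True assms
    by (simp add: mm_matrix_def)
qed (simp add: mm_matrix_def)

text \<open>Applied to the middle row of a dyadic block, this shows that its neighbours in the
  recursion of \<open>delta\<close> are the two ends of the block.\<close>

lemma multiplicity_2_odd_multiple: "multiplicity 2 (2 ^ s * (2 * c + 1) :: nat) = s"
proof (rule multiplicity_eqI)
  show "\<not> 2 ^ Suc s dvd 2 ^ s * (2 * c + 1)"
    unfolding power_Suc2 by (subst nat_mult_dvd_cancel_disj) simp
qed simp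

(* The block of rows strictly between l and r, two consecutive multiples of 2^s. *)
lemma monotone_maxima_loss:
  fixes g h :: "nat \<Rightarrow> real" and D :: "nat \<Rightarrow> ereal" and l r s c N p i :: nat
  defines "A \<equiv> mm_matrix g h D"
  assumes "l = 2 ^ s * c" "r = l + 2 ^ s" "r \<le> N" "1 \<le> L" "L \<le> R"
    and left: "l = 0 \<and> L = 1 \<or>
      0 < l \<and> L \<le> l \<and> (\<forall>i. A l i \<le> A l L + ereal (delta N g h l))"
    and right: "r = N \<and> R = N - 1 \<or>
      r < N \<and> (\<forall>i. A r i \<le> A r R + ereal (delta N g h r))"
    and "l < p" "p < r"
  shows "A p i \<le> A p (monotone_maxima A (l + 1) (r - 1) L R p) + ereal (delta N g h p)"
  using assms(2-)
\<comment> \<open>\<open>left\<close> and \<open>right\<close> are the invariants of the recursion: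
  a processed end row loses at most its \<open>delta\<close> in its chosen column, compared with all
  columns. The ends \<open>0\<close> and \<open>N\<close> stand for missing rows, and there the
  range is still uncut.\<close>
proof (induction s arbitrary: l r c L R p i)
  case 0
  then show ?case by simp
next
  case (Suc s)
  define m where "m = l + 2 ^ s"
  define j where "j = leftmost_argmax (A m) L R"
  have m: "m = 2 ^ s * (2 * c + 1)"
    using Suc.prems by (simp add: m_def)
  then have mult: "multiplicity 2 m = s"
    using multiplicity_2_odd_multiple by simp
  have lm: "l = m - 2 ^ s" and rm: "r = m + 2 ^ s" and "l < m" "m < r" "0 < m" "m < N"
    using Suc.prems by (simp_all add: m_def)
  have mid: "(l + 1 + (r - 1)) div 2 = m"
    using rm by (simp add: m_def)
  have j: "L \<le> j" "j \<le> R" and j_max: "\<And>i. i \<in> {L..R} \<Longrightarrow> A m i \<le> A m j"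
    using leftmost_argmax[OF \<open>L \<le> R\<close>] by (auto simp: j_def)
  have "L \<le> m"
    using Suc.prems(6) \<open>l < m\<close> by auto
  \<comment> \<open>Needed when row \<open>m\<close> becomes the left end of a block, for the
    conjunct \<open>L \<le> l\<close> of \<open>left\<close>.\<close>
  then have "j \<le> m"
    unfolding j_def using \<open>L \<le> R\<close> by (intro leftmost_argmax_le) (auto simp: A_def mm_matrix_def)
  note \<delta> = delta_ge[OF \<open>0 < m\<close> \<open>m < N\<close> mult[symmetric], of g h, folded lm rm]
  have *: "A m i \<le> A m j + ereal (delta N g h m)" for i
  proof -
    \<comment> \<open>Any column of the range will do, since \<open>j\<close> is best among them:
      \<open>L\<close> if \<open>i\<close> is to its left, \<open>R\<close> if \<open>i\<close> is
      to its right, and otherwise \<open>i\<close> itself.\<close>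
    have "\<exists>i'\<in>{L..R}. A m i \<le> A m i' + ereal (delta N g h m)"
    proof -
      consider "i < L" | "i \<in> {L..R}" | "R < i" by fastforce
      then show ?thesis
      proof cases
        case 1
        from Suc.prems(6) show ?thesis
        proof
          assume "l = 0 \<and> L = 1"
          \<comment> \<open>Only the dummy column \<open>0\<close> lies left of
            \<open>L = 1\<close>.\<close>
          with 1 have "A m i = -\<infinity>" by (simp add: A_def mm_matrix_def)
          with \<open>L \<le> R\<close> show ?thesis by auto
        next
          assume "0 < l \<and> L \<le> l \<and> (\<forall>i. A l i \<le> A l L + ereal (delta N g h l))"
          then have "A m i \<le> A m L + ereal (delta N g h m)"
            using mm_matrix_exchange_left[of l m N i L g h D "delta N g h l"]
              \<open>l < m\<close> \<open>m < N\<close> 1 \<delta>(1) unfolding A_def by blast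
          with \<open>L \<le> R\<close> show ?thesis by auto
        qed
      next
        case 2
        have "A m i + 0 \<le> A m i + ereal (delta N g h m)"
          using \<delta>(2) by (intro add_left_mono) simp
        with 2 show ?thesis by auto
      next
        case 3
        from Suc.prems(7) show ?thesis
        proof
          assume "r = N \<and> R = N - 1"
          with 3 \<open>m < N\<close> have "A m i = -\<infinity>" by (simp add: A_def mm_matrix_def)
          with \<open>L \<le> R\<close> show ?thesis by auto
        next
          assume "r < N \<and> (\<forall>i. A r i \<le> A r R + ereal (delta N g h r))"
          moreover have "1 \<le> R"
            using \<open>1 \<le> L\<close> \<open>L \<le> R\<close> by simp
          ultimately have "A m i \<le> A m R + ereal (delta N g h m)"
            using mm_matrix_exchange_right[of m r N R i g h D "delta N g h r"]
              \<open>0 < m\<close> \<open>m < r\<close> 3 \<delta>(3) unfolding A_def by blast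
          with \<open>L \<le> R\<close> show ?thesis by auto
        qed
      qed
    qed
    then obtain i' where "i' \<in> {L..R}" "A m i \<le> A m i' + ereal (delta N g h m)" ..
    moreover have "A m i' + ereal (delta N g h m) \<le> A m j + ereal (delta N g h m)"
      using j_max[OF \<open>i' \<in> {L..R}\<close>] by (rule add_right_mono)
    ultimately show ?thesis by order
  qed
  have unfold: "monotone_maxima A (l + 1) (r - 1) L R p =
      (if p < m then monotone_maxima A (l + 1) (m - 1) L j p
       else if p = m then j else monotone_maxima A (m + 1) (r - 1) j R p)"
  proof -
    have "1 \<le> l + 1 \<and> l + 1 \<le> r - 1"
      using \<open>l < m\<close> \<open>m < r\<close> by simp
    then show ?thesis
      by (subst monotone_maxima.simps) (simp only: Let_def mid j_def[symmetric] simp_thms if_True)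
  qed
  \<comment> \<open>In units of \<open>2 ^ s\<close>, the two halves start at \<open>2 * c\<close>
    and \<open>2 * c + 1\<close>; \<open>*\<close> provides the invariant for row \<open>m\<close>
    as their new common end.\<close>
  consider "p < m" | "p = m" | "m < p" by linarith
  then show ?case
  proof cases
    case 1
    have "A p i \<le> A p (monotone_maxima A (l + 1) (m - 1) L j p) + ereal (delta N g h p)"
      using Suc.prems j * \<open>m < N\<close> 1 by (intro Suc.IH[where c = "2 * c"]) (auto simp: m_def)
    with 1 show ?thesis unfolding unfold by simp
  next
    case 2
    with * show ?thesis unfolding unfold by simp
  next
    case 3
    have "A p i \<le> A p (monotone_maxima A (m + 1) (r - 1) j R p) + ereal (delta N g h p)"
      using Suc.prems j * \<open>j \<le> m\<close> \<open>0 < m\<close> 3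
      by (intro Suc.IH[where c = "2 * c + 1"]) (auto simp: m rm)
    with 3 show ?thesis unfolding unfold by simp
  qed
qed

text \<open>Each matrix entry is minus infinity or, by induction, at most a candidate in the exact
  maximum. The bound therefore holds whatever column the algorithm returns.\<close>

lemma DP_mm_le_DP_true: "DP_mm N g h p q \<le> DP_true g h p q"
proof (induction q arbitrary: p)
  case 0
  show ?case by (cases p) simp_all
next
  case (Suc q)
  show ?case
  proof (cases p)
    case 0
    then show ?thesis by simp
  next
    case p: (Suc n)
    have "mm_matrix g h (\<lambda>i. DP_mm N g h i q) p i \<le> DP_true g h p (Suc q)" for i
    proof (cases "i \<in> {1..p}")
      case True
      then have "mm_matrix g h (\<lambda>i. DP_mm N g h i q) p i
          \<le> DP_true g h (i - 1) q + ereal (d_KL g h i p)"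
        using Suc.IH[of "i - 1"] by (simp add: mm_matrix_def add_right_mono)
      also have "\<dots> \<le> DP_true g h p (Suc q)"
        unfolding p DP_true.simps using True p by (intro Max_ge) auto
      finally show ?thesis .
    qed (auto simp: mm_matrix_def)
    then show ?thesis
      by (simp add: p Let_def)
  qed
qed

lemma delta_le_delta_max:
  assumes "p \<in> {1..N - 1}"
  shows "delta N g h p \<le> delta_max N g h"
  unfolding delta_max_def using assms by (intro Max_ge) auto

text \<open>Row \<open>0\<close> is included because the recursion refers to row
  \<open>i - 1\<close>. Each candidate of the exact maximum inherits the loss of the previous
  column, and the choice of column adds at most \<open>delta_max\<close>.\<close>

lemma DP_true_le_DP_mm:
  assumes N: "N = 2 ^ M" and "p < N"
  shows "DP_true g h p q \<le> DP_mm N g h p q + ereal (real q * delta_max N g h)"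
  using \<open>p < N\<close>
proof (induction q arbitrary: p)
  case 0
  show ?case by (cases p) simp_all
next
  case (Suc q)
  show ?case
  proof (cases p)
    case 0
    then show ?thesis by simp
  next
    case p: (Suc n)
    let ?A = "mm_matrix g h (\<lambda>i. DP_mm N g h i q)"
    let ?J = "monotone_maxima ?A 1 (N - 1) 1 (N - 1)"
    have "DP_true g h (i - 1) q + ereal (d_KL g h i p)
        \<le> DP_mm N g h p (Suc q) + ereal (real (Suc q) * delta_max N g h)"
      if i: "i \<in> {1..p}" for i
    proof -
      have "i - 1 < N"
        using i Suc.prems by auto
      then have "DP_true g h (i - 1) q + ereal (d_KL g h i p)
          \<le> DP_mm N g h (i - 1) q + ereal (real q * delta_max N g h) + ereal (d_KL g h i p)"
        by (intro add_right_mono Suc.IH)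
      also have "\<dots> = ?A p i + ereal (real q * delta_max N g h)"
        using i by (simp add: mm_matrix_def ac_simps)
      \<comment> \<open>The whole run is the block between \<open>0\<close> and \<open>N\<close>,
        with \<open>s = M\<close> and \<open>c = 0\<close>, where both end rows are missing.\<close>
      also have "?A p i \<le> ?A p (?J p) + ereal (delta N g h p)"
        using monotone_maxima_loss[of 0 M 0 N N 1 "N - 1" g h "\<lambda>i. DP_mm N g h i q" p i] N p
          Suc.prems by simp
      also have "ereal (delta N g h p) \<le> ereal (delta_max N g h)"
        using delta_le_delta_max[of p N g h] p Suc.prems by simp
      also have "?A p (?J p) + ereal (delta_max N g h) + ereal (real q * delta_max N g h)
          = DP_mm N g h p (Suc q) + ereal (real (Suc q) * delta_max N g h)"
      proof -
        have "ereal (real (Suc q) * delta_max N g h)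
            = ereal (delta_max N g h) + ereal (real q * delta_max N g h)"
          by (simp add: algebra_simps)
        then show ?thesis
          by (simp only: p DP_mm.simps Let_def add.assoc)
      qed
      finally show ?thesis
        by (simp add: add_left_mono add_right_mono)
    qed
    then show ?thesis
      using p by (simp del: DP_mm.simps of_nat_Suc)
  qed
qed

theorem theorem9:
  fixes M N k p q :: nat and g h :: "nat \<Rightarrow> real"
  assumes "M \<ge> 1" and "N = 2 ^ M"
    and "2 \<le> k" and "k < N"
    and "\<And>i. i \<in> {1..N} \<Longrightarrow> g i \<ge> 0"
    and "\<And>i. i \<in> {1..N} \<Longrightarrow> h i > 0"
    and "(\<Sum>i=1..N. g i) = 1" and "(\<Sum>i=1..N. h i) = 1"
    and "p \<in> {1..N - 1}" and "q \<in> {1..k - 1}"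
  shows "DP_mm N g h p q \<le> DP_true g h p q
       \<and> DP_true g h p q \<le> DP_mm N g h p q + ereal (real q * delta_max N g h)"
  using DP_mm_le_DP_true DP_true_le_DP_mm[OF assms(2), of p g h q] assms(9) by auto

end
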